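(* The additive group of the Banach space $c_0$, with the topology induced by its norm, is not reflexively representable.
   Context: $c_0$ is the Banach space of real sequences converging to $0$ with the supremum norm. A topological group $G$ is reflexively representable if there exist a reflexive Banach space $E$ and a group homomorphism from $G$ into the group of surjective linear isometries of $E$ which is a topological isomorphism onto its image, where the isometry group carries the strong operator topology (the weakest topology making the maps $T\mapsto Tv$, $v\in E$, continuous); equivalently, with the weak operator topology. *)

theory Defs
  imports "HOL-Analysis.Analysis" "HOL-Algebra.Group"
begin

text \<open>Since the topology of \<^typ>\<open>nat\<close> is discrete, \<^typ>\<open>nat \<Rightarrow>\<^sub>C real\<close> is the Banach space of all
  bounded real sequences with the supremum norm.\<close>

definition c0 :: "(nat \<Rightarrow>\<^sub>C real) set" where
  "c0 = {x. (\<lambda>n. apply_bcontfun x n) \<longlonglongrightarrow> 0}"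

definition c0_group :: "(nat \<Rightarrow>\<^sub>C real) monoid" where
  "c0_group = \<lparr>carrier = c0, mult = (+), one = 0\<rparr>"

definition reflexive_space :: "'e::real_normed_vector itself \<Rightarrow> bool" where
  "reflexive_space _ \<longleftrightarrow>
     (\<forall>\<phi> :: ('e \<Rightarrow>\<^sub>L real) \<Rightarrow>\<^sub>L real. \<exists>x :: 'e. \<forall>f. blinfun_apply \<phi> f = blinfun_apply f x)"

definition isometry_group :: "('e::real_normed_vector \<Rightarrow>\<^sub>L 'e) monoid" where
  "isometry_group =
     \<lparr>carrier = {T. surj (blinfun_apply T) \<and> (\<forall>v. norm (blinfun_apply T v) = norm v)},
      mult = (o\<^sub>L), one = id_blinfun\<rparr>"

text \<open>A topological group, given by a group \<^term>\<open>G\<close> and a topology \<^term>\<open>X\<close> on its carrier, is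
  reflexively representable iff the predicate below holds for some Banach space \<^typ>\<open>'e\<close>.
  HOL cannot quantify over types inside a formula, so the Banach space is a parameter;
  non-representability is the negation of the predicate for an arbitrary type \<^typ>\<open>'e\<close>.\<close>

definition reflexively_representable_on ::
  "'e::banach itself \<Rightarrow> ('g, 'm) monoid_scheme \<Rightarrow> 'g topology \<Rightarrow> bool" where
  "reflexively_representable_on E G X \<longleftrightarrow>
     reflexive_space E \<and>
     (\<exists>h :: 'g \<Rightarrow> ('e \<Rightarrow>\<^sub>L 'e).
        h \<in> hom G isometry_group \<and>
        embedding_map X (subtopology strong_operator_topology (carrier isometry_group)) h)"

lemma norm_c0: "norm x = (SUP n. \<bar>apply_bcontfun x n\<bar>)" for x :: "nat \<Rightarrow>\<^sub>C real"
  by (simp add: norm_bcontfun_def dist_bcontfun_def)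

lemma range_apply_bcontfun_nat:
  "range (apply_bcontfun :: (nat \<Rightarrow>\<^sub>C real) \<Rightarrow> _) = {x. bounded (range x)}"
proof (intro equalityI subsetI)
  fix x :: "nat \<Rightarrow> real" assume "x \<in> {x. bounded (range x)}"
  then have "x \<in> bcontfun"
    by (simp add: bcontfun_def)
  then show "x \<in> range apply_bcontfun"
    by (metis Bcontfun_inverse rangeI)
qed auto

lemma subspace_c0: "subspace c0"
  by (auto simp: subspace_def c0_def intro: tendsto_add_zero tendsto_mult_right_zero)

lemma group_c0_group: "group c0_group"
proof (rule groupI)
  fix x assume "x \<in> carrier c0_group"
  then show "\<exists>y\<in>carrier c0_group. y \<otimes>\<^bsub>c0_group\<^esub> x = \<one>\<^bsub>c0_group\<^esub>"
    by (intro bexI[of _ "- x"]) (simp_all add: c0_group_def subspace_neg[OF subspace_c0])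
qed (simp_all add: c0_group_def subspace_add[OF subspace_c0] subspace_0[OF subspace_c0] add.assoc)

lemma group_isometry_group: "group (isometry_group :: ('e::real_normed_vector \<Rightarrow>\<^sub>L 'e) monoid)"
proof (rule groupI)
  fix T :: "'e \<Rightarrow>\<^sub>L 'e"
  assume "T \<in> carrier isometry_group"
  then have s: "surj (blinfun_apply T)" and n: "\<And>v. norm (blinfun_apply T v) = norm v"
    by (auto simp: isometry_group_def)
  have "inj (blinfun_apply T)"
  proof (rule injI)
    fix u v assume "blinfun_apply T u = blinfun_apply T v"
    then have "norm (u - v) = 0"
      using n[of "u - v"] by (simp add: blinfun.diff_right)
    then show "u = v" by simp
  qed
  with s have b: "bij (blinfun_apply T)" by (simp add: bij_def)
  let ?S = "inv_into UNIV (blinfun_apply T)"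
  have TS: "blinfun_apply T (?S v) = v" for v
    by (simp add: s surj_f_inv_f)
  have ST: "?S (blinfun_apply T v) = v" for v
    by (simp add: \<open>inj (blinfun_apply T)\<close>)
  have nS: "norm (?S v) = norm v" for v
    using n[of "?S v"] TS by simp
  have bl: "bounded_linear ?S"
  proof (rule bounded_linear_intro)
    fix x y show "?S (x + y) = ?S x + ?S y"
      by (metis ST TS blinfun.add_right)
  next
    fix r x show "?S (r *\<^sub>R x) = r *\<^sub>R ?S x"
      by (metis ST TS blinfun.scaleR_right)
  next
    fix x show "norm (?S x) \<le> norm x * 1" by (simp add: nS)
  qed
  show "\<exists>R\<in>carrier isometry_group. R \<otimes>\<^bsub>isometry_group\<^esub> T = \<one>\<^bsub>isometry_group\<^esub>"
  proof (rule bexI[of _ "Blinfun ?S"])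
    show "Blinfun ?S \<in> carrier isometry_group"
      using b by (simp add: isometry_group_def bounded_linear_Blinfun_apply[OF bl] nS
          bij_imp_bij_inv bij_is_surj)
    show "Blinfun ?S \<otimes>\<^bsub>isometry_group\<^esub> T = \<one>\<^bsub>isometry_group\<^esub>"
      by (simp add: isometry_group_def blinfun_eqI bounded_linear_Blinfun_apply[OF bl] ST)
  qed
next
  fix S T :: "'e \<Rightarrow>\<^sub>L 'e"
  assume "S \<in> carrier isometry_group" "T \<in> carrier isometry_group"
  then show "S \<otimes>\<^bsub>isometry_group\<^esub> T \<in> carrier isometry_group"
    by (simp add: isometry_group_def surj_def) metis
qed (auto simp: isometry_group_def intro!: blinfun_eqI)

end

theory Submission imports Defs begin

text \<open>Let \<open>h\<close> represent \<open>c0\<close> isometrically on a reflexive space, let \<open>s\<^sub>n\<close> be the summing basis and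
  \<open>\<epsilon> = 1/k\<close>, and let \<open>P\<close>, \<open>Q\<close> be weak operator limits of \<open>h (\<epsilon> s\<^sub>n)\<close>, \<open>h (- \<epsilon> s\<^sub>n)\<close> along one
  ultrafilter. These commute because \<open>c0\<close> is abelian and bounded operators are weakly continuous.
  Reading \<open>(P Q)\<^sup>k\<close> as an iterated limit over interlaced indices, only vectors of norm at most
  \<open>\<epsilon>\<close> occur, so \<open>(P Q)\<^sup>k\<close> moves each vector only slightly; reading \<open>Q\<^sup>k P\<^sup>k\<close> as an iterated limit
  over separated indices shows that it is a weak operator limit of \<open>h x\<close> with \<open>norm x \<ge> 1\<close>. Hence
  such \<open>h x\<close> come weakly arbitrarily close to the identity. Since a bounded separable subset of a
  reflexive space has nonempty relatively weakly open pieces of small diameter, the weak and the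
  norm topology agree on orbits, so \<open>h x\<close> also comes strongly close to the identity, and \<open>h\<close>
  is not an embedding.\<close>

section \<open>The Hahn--Banach theorem\<close>

text \<open>Scaling is demanded only as an inequality, which is quicker to verify; equality follows
  by applying it again with the inverse factor, see \<open>sublinear_scale_eq\<close>.\<close>

definition sublinear :: "('a::real_vector \<Rightarrow> real) \<Rightarrow> bool" where
  "sublinear p \<longleftrightarrow> (\<forall>x y. p (x + y) \<le> p x + p y) \<and> (\<forall>t\<ge>0. \<forall>x. p (t *\<^sub>R x) \<le> t * p x)"

lemma sublinearI:
  assumes "\<And>x y. p (x + y) \<le> p x + p y" "\<And>t x. t \<ge> 0 \<Longrightarrow> p (t *\<^sub>R x) \<le> t * p x"
  shows "sublinear p"
  using assms by (simp add: sublinear_def)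

lemma sublinear_add: "sublinear p \<Longrightarrow> p (x + y) \<le> p x + p y"
  and sublinear_scale: "sublinear p \<Longrightarrow> 0 \<le> t \<Longrightarrow> p (t *\<^sub>R x) \<le> t * p x"
  by (auto simp: sublinear_def)

lemma sublinear_zero: "sublinear p \<Longrightarrow> p 0 = 0"
  using sublinear_add[of p 0 0] sublinear_scale[of p 0 0] by simp

lemma sublinear_scale_eq:
  assumes p: "sublinear p" and t: "0 \<le> t"
  shows "p (t *\<^sub>R x) = t * p x"
proof (cases "t = 0")
  case True
  then show ?thesis by (simp add: sublinear_zero[OF p])
next
  case False
  with t have "t * p x \<le> p (t *\<^sub>R x)"
    using sublinear_scale[OF p, of "inverse t" "t *\<^sub>R x"] by (simp add: field_simps)
  with sublinear_scale[OF p t] show ?thesis by (rule antisym)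
qed

lemma sublinear_minus: "sublinear p \<Longrightarrow> - p (- x) \<le> p x"
  using sublinear_add[of p x "- x"] by (simp add: sublinear_zero)

text \<open>Supplies the lower bounds for Zorn's lemma. The infimum is finite since
  \<open>q x\<close> is at least \<open>- p (- x)\<close> for every \<open>q\<close> in the chain.
  It is subadditive because of two members the smaller one bounds both terms at once.\<close>

lemma sublinear_INF_chain:
  fixes C :: "('a::real_vector \<Rightarrow> real) set"
  assumes C: "C \<noteq> {}" "\<And>q. q \<in> C \<Longrightarrow> sublinear q" "\<And>q. q \<in> C \<Longrightarrow> q \<le> p"
    and chain: "\<And>q r. q \<in> C \<Longrightarrow> r \<in> C \<Longrightarrow> q \<le> r \<or> r \<le> q"
  shows "sublinear (\<lambda>x. INF q\<in>C. q x)" "q \<in> C \<Longrightarrow> (\<lambda>x. INF q\<in>C. q x) \<le> q"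
proof -
  have bdd: "bdd_below ((\<lambda>q. q x) ` C)" for x
    using sublinear_minus[OF C(2), of _ x] C(3)
    by (intro bdd_belowI[of _ "- p (- x)"]) (force simp: le_fun_def intro: order_trans[rotated])
  have low: "(INF q\<in>C. q x) \<le> q x" if "q \<in> C" for q x
    using bdd that by (intro cINF_lower)
  then show "q \<in> C \<Longrightarrow> (\<lambda>x. INF q\<in>C. q x) \<le> q"
    by (simp add: le_fun_def)
  show "sublinear (\<lambda>x. INF q\<in>C. q x)"
  proof (rule sublinearI)
    fix x y
    have "(INF q\<in>C. q (x + y)) \<le> q x + r y" if qr: "q \<in> C" "r \<in> C" for q r
    proof -
      obtain s where s: "s \<in> C" "s \<le> q" "s \<le> r"
        using chain[OF qr] qr by auto
      have "(INF q\<in>C. q (x + y)) \<le> s x + s y"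
        using low[OF s(1)] sublinear_add[OF C(2)[OF s(1)]] by (meson order_trans)
      also have "\<dots> \<le> q x + r y"
        using s by (auto simp: le_fun_def add_mono)
      finally show ?thesis .
    qed
    then have "(INF q\<in>C. q (x + y)) - r y \<le> (INF q\<in>C. q x)" if "r \<in> C" for r
      using C(1) that by (intro cINF_greatest) (auto simp: diff_le_eq)
    then have "(INF q\<in>C. q (x + y)) - (INF q\<in>C. q x) \<le> (INF q\<in>C. q y)"
      using C(1) by (intro cINF_greatest) (auto simp: algebra_simps)
    then show "(INF q\<in>C. q (x + y)) \<le> (INF q\<in>C. q x) + (INF q\<in>C. q y)"
      by simp
  next
    fix t :: real and x assume t: "t \<ge> 0"
    have le: "(INF q\<in>C. q (t *\<^sub>R x)) \<le> t * q x" if "q \<in> C" for q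
      using low[OF that] sublinear_scale[OF C(2)[OF that] t] by (meson order_trans)
    show "(INF q\<in>C. q (t *\<^sub>R x)) \<le> t * (INF q\<in>C. q x)"
    proof (cases "t = 0")
      case True
      then show ?thesis using le C(1) by fastforce
    next
      case False
      with t le have "(INF q\<in>C. q (t *\<^sub>R x)) / t \<le> (INF q\<in>C. q x)"
        using C(1) by (intro cINF_greatest) (auto simp: divide_le_eq mult.commute)
      with False t show ?thesis by (simp add: divide_le_eq mult.commute)
    qed
  qed
qed

text \<open>The infimum of \<open>p (x + t *\<^sub>R y) - t * p y\<close> over t \<ge> 0 works: t =
  0 gives \<open>q \<le> p\<close>, t = 1 gives the last inequality, and \<open>- p (- x)\<close> is
  a lower bound.\<close>

lemma sublinear_shift:
  fixes p :: "'a::real_vector \<Rightarrow> real"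
  assumes p: "sublinear p"
  obtains q where "sublinear q" "q \<le> p" "\<And>x. q x \<le> p (x + y) - p y"
proof
  let ?g = "\<lambda>x t. p (x + t *\<^sub>R y) - t * p y"
  let ?q = "\<lambda>x. INF t\<in>{0..}. ?g x t"
  have bdd: "bdd_below (?g x ` {0..})" for x
  proof (rule bdd_belowI2[of _ "- p (- x)"])
    fix t :: real assume "t \<in> {0..}"
    then show "- p (- x) \<le> ?g x t"
      using sublinear_add[OF p, of "x + t *\<^sub>R y" "- x"] sublinear_scale_eq[OF p, of t y] by simp
  qed
  have low: "?q x \<le> ?g x t" if "t \<ge> 0" for x t
    using bdd that by (intro cINF_lower) auto
  show "?q \<le> p"
    using low[of 0] by (simp add: le_fun_def)
  show "?q x \<le> p (x + y) - p y" for x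
    using low[of 1 x] by simp
  show "sublinear ?q"
  proof (rule sublinearI)
    fix u v
    have "?q (u + v) \<le> ?g u s + ?g v t" if "s \<ge> 0" "t \<ge> 0" for s t
      using low[of "s + t" "u + v"] that
        sublinear_add[OF p, of "u + s *\<^sub>R y" "v + t *\<^sub>R y"]
      by (simp add: algebra_simps)
    then have "?q (u + v) - ?g v t \<le> ?q u" if "t \<ge> 0" for t
      using that by (intro cINF_greatest) (auto simp: algebra_simps)
    then have "?q (u + v) - ?q u \<le> ?q v"
      by (intro cINF_greatest) (auto simp: algebra_simps)
    then show "?q (u + v) \<le> ?q u + ?q v" by simp
  next
    fix c :: real and x assume c: "c \<ge> 0"
    have le: "?q (c *\<^sub>R x) \<le> c * ?g x t" if "t \<ge> 0" for t
      using low[of "c * t" "c *\<^sub>R x"] that c sublinear_scale[OF p c, of "x + t *\<^sub>R y"]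
      by (simp add: algebra_simps)
    show "?q (c *\<^sub>R x) \<le> c * ?q x"
    proof (cases "c = 0")
      case True
      then show ?thesis using le[of 0] by simp
    next
      case False
      with c le have "?q (c *\<^sub>R x) / c \<le> ?q x"
        by (intro cINF_greatest) (auto simp: divide_le_eq mult.commute)
      with False c show ?thesis by (simp add: divide_le_eq mult.commute)
    qed
  qed
qed

text \<open>A minimal sublinear functional coincides with all of its shifts, which makes it additive.\<close>

theorem hahn_banach_sublinear:
  fixes p :: "'a::real_vector \<Rightarrow> real"
  assumes p: "sublinear p"
  obtains f where "linear f" "\<And>x. f x \<le> p x" "f y = p y"
proof -
  \<comment> \<open>Shifting by \<open>y\<close> before minimising forces
    \<open>m (- y) \<le> - p y\<close>, hence \<open>m y = p y\<close> in the end.\<close>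
  obtain p' where p': "sublinear p'" "p' \<le> p" "\<And>x. p' x \<le> p (x + y) - p y"
    using sublinear_shift[OF p] by blast
  define S where "S = {q. sublinear q \<and> q \<le> p'}"
  have "\<exists>m\<in>S. \<forall>q\<in>S. m \<ge> q \<longrightarrow> q = m"
  proof (rule predicate_Zorn)
    show "partial_order_on S (relation_of (\<ge>) S)"
      by (rule partial_order_on_relation_ofI) auto
    fix C assume C: "C \<in> Chains (relation_of (\<ge>) S)"
    then have CS: "C \<subseteq> S" and ch: "\<And>q r. q \<in> C \<Longrightarrow> r \<in> C \<Longrightarrow> q \<le> r \<or> r \<le> q"
      by (auto simp: Chains_def relation_of_def)
    show "\<exists>u\<in>S. \<forall>a\<in>C. a \<ge> u"
    proof (cases "C = {}")
      case True
      then show ?thesis using p'(1) by (auto simp: S_def)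
    next
      case False
      have sl: "q \<in> C \<Longrightarrow> sublinear q" and le: "q \<in> C \<Longrightarrow> q \<le> p'" for q
        using CS by (auto simp: S_def)
      have I: "sublinear (\<lambda>x. INF q\<in>C. q x)" "r \<in> C \<Longrightarrow> (\<lambda>x. INF q\<in>C. q x) \<le> r" for r
        using sublinear_INF_chain[of C p'] False sl le ch by blast+
      obtain q where "q \<in> C" using False by blast
      have "(\<lambda>x. INF q\<in>C. q x) \<in> S"
        using I(1) order_trans[OF I(2) le] \<open>q \<in> C\<close> by (simp add: S_def)
      then show ?thesis using I(2) by blast
    qed
  qed
  then obtain m where m: "sublinear m" "m \<le> p'"
    and min: "\<And>q. sublinear q \<Longrightarrow> q \<le> m \<Longrightarrow> q = m"
    unfolding S_def by (auto intro: order_trans)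
  have add: "m (u + v) = m u + m v" for u v
  proof -
    obtain q where q: "sublinear q" "q \<le> m" "\<And>x. q x \<le> m (x + v) - m v"
      using sublinear_shift[OF m(1)] by blast
    show ?thesis
      using q(3)[of u] min[OF q(1,2)] sublinear_add[OF m(1), of u v] by simp
  qed
  have neg: "m (- u) = - m u" for u
    using add[of u "- u"] sublinear_zero[OF m(1)] by simp
  have pos: "m (t *\<^sub>R u) = t * m u" if "t \<ge> 0" for t u
    using sublinear_scale[OF m(1) that, of u] sublinear_scale[OF m(1) that, of "- u"]
    by (simp add: neg)
  have scale: "m (t *\<^sub>R u) = t * m u" for t u
    using pos[of t u] pos[of "- t" u] neg[of "t *\<^sub>R u"] by (cases "t \<ge> 0") auto
  have le: "m x \<le> p x" for x
    using m(2) p'(2) by (auto simp: le_fun_def intro: order_trans)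
  have "m (- y) \<le> p (- y + y) - p y"
    using m(2) p'(3)[of "- y"] by (meson le_funD order_trans)
  then have "m y = p y"
    using le[of y] by (simp add: neg sublinear_zero[OF p])
  with add scale le show ?thesis
    by (intro that[of m]) (auto intro: linearI)
qed

section \<open>Norming and separating functionals\<close>

lemma norming_functional:
  fixes x :: "'a::real_normed_vector"
  obtains f :: "'a \<Rightarrow>\<^sub>L real" where "norm f \<le> 1" "blinfun_apply f x = norm x"
proof -
  have "sublinear (norm :: 'a \<Rightarrow> real)"
    by (rule sublinearI) (auto intro: norm_triangle_ineq)
  then obtain f where f: "linear f" "\<And>u. f u \<le> norm u" "f x = norm x"
    by (rule hahn_banach_sublinear[of norm x]) blast
  have b: "\<bar>f u\<bar> \<le> norm u" for u
    using f(2)[of u] f(2)[of "- u"] linear_neg[OF f(1), of u] by simp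
  then have "bounded_linear f"
    using f(1) by (intro bounded_linear.intro)
      (auto simp: bounded_linear_axioms_def linear_conv_bounded_linear intro: exI[of _ 1])
  then show ?thesis
    using b f(3) by (intro that[of "Blinfun f"])
      (auto simp: bounded_linear_Blinfun_apply intro!: norm_blinfun_bound)
qed

lemma blinfun_separates:
  fixes x y :: "'a::real_normed_vector"
  assumes "\<And>f :: 'a \<Rightarrow>\<^sub>L real. blinfun_apply f x = blinfun_apply f y"
  shows "x = y"
  using norming_functional[of "x - y"] assms by (metis blinfun.diff_right eq_iff_diff_eq_0 norm_eq_zero)

text \<open>Hahn--Banach applied to the distance from \<open>S\<close>. It vanishes on
  \<open>S\<close>, so \<open>f\<close> does too; it is positive at \<open>x\<close> since
  \<open>S\<close> is closed; and it is at most the norm since 0 lies in \<open>S\<close>, so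
  \<open>f\<close> is bounded.\<close>

lemma separating_functional:
  fixes S :: "'a::real_normed_vector set"
  assumes S: "subspace S" "closed S" "x \<notin> S"
  obtains f :: "'a \<Rightarrow>\<^sub>L real" where "\<And>s. s \<in> S \<Longrightarrow> blinfun_apply f s = 0" "blinfun_apply f x > 0"
proof -
  let ?p = "\<lambda>x. infdist x S"
  have ne: "S \<noteq> {}" using subspace_0[OF S(1)] by blast
  have approx: "\<exists>s\<in>S. norm (u - s) < ?p u + e" if "e > 0" for u e
  proof -
    have "\<exists>z\<in>dist u ` S. z < ?p u + e"
      using ne that by (subst cInf_less_iff[symmetric]) (auto simp: infdist_def)
    then show ?thesis by (auto simp: dist_norm)
  qed
  have low: "?p u \<le> norm (u - s)" if "s \<in> S" for u s
    using infdist_le[OF that, of u] by (simp add: dist_norm)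
  have "sublinear ?p"
  proof (rule sublinearI)
    fix u v
    show "?p (u + v) \<le> ?p u + ?p v"
    proof (rule field_le_epsilon)
      fix e :: real assume "e > 0"
      then obtain s t where st: "s \<in> S" "t \<in> S"
        "norm (u - s) < ?p u + e / 2" "norm (v - t) < ?p v + e / 2"
        using approx[of "e / 2"] by (metis half_gt_zero)
      have "?p (u + v) \<le> norm ((u - s) + (v - t))"
        using low[OF subspace_add[OF S(1) st(1,2)], of "u + v"] by (simp add: algebra_simps)
      also have "\<dots> \<le> norm (u - s) + norm (v - t)" by (rule norm_triangle_ineq)
      finally show "?p (u + v) \<le> ?p u + ?p v + e" using st by simp
    qed
  next
    fix t :: real and u assume t: "t \<ge> 0"
    show "?p (t *\<^sub>R u) \<le> t * ?p u"
    proof (cases "t = 0")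
      case True
      then show ?thesis using subspace_0[OF S(1)] by simp
    next
      case False
      have "?p (t *\<^sub>R u) / t \<le> ?p u + e" if e: "e > 0" for e
      proof -
        obtain s where s: "s \<in> S" "norm (u - s) < ?p u + e" using approx[OF e] by blast
        have "?p (t *\<^sub>R u) \<le> norm (t *\<^sub>R (u - s))"
          using low[OF subspace_scale[OF S(1) s(1)], of "t *\<^sub>R u"] by (simp add: algebra_simps)
        then have "?p (t *\<^sub>R u) / t \<le> norm (u - s)"
          using t False by (simp add: divide_le_eq mult.commute)
        with s show ?thesis by simp
      qed
      then have "?p (t *\<^sub>R u) / t \<le> ?p u" by (rule field_le_epsilon)
      then show ?thesis using t False by (simp add: divide_le_eq mult.commute)
    qed
  qed
  then obtain f where f: "linear f" "\<And>u. f u \<le> ?p u" "f x = ?p x"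
    by (rule hahn_banach_sublinear[of ?p x]) blast
  have "\<bar>f u\<bar> \<le> norm u" for u
    using f(2)[of u] f(2)[of "- u"] linear_neg[OF f(1), of u] low[OF subspace_0[OF S(1)], of u]
      low[OF subspace_0[OF S(1)], of "- u"] by simp
  then have bl: "bounded_linear f"
    using f(1) by (intro bounded_linear.intro)
      (auto simp: bounded_linear_axioms_def linear_conv_bounded_linear intro: exI[of _ 1])
  have "f s = 0" if "s \<in> S" for s
    using f(2)[of s] f(2)[of "- s"] linear_neg[OF f(1), of s] that subspace_neg[OF S(1) that] by simp
  moreover have "f x > 0"
    using f(3) in_closed_iff_infdist_zero[OF S(2) ne, of x] S(3) infdist_nonneg[of x S] by linarith
  ultimately show ?thesis
    using bl by (intro that[of "Blinfun f"]) (auto simp: bounded_linear_Blinfun_apply)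
qed

section \<open>Weak limits in reflexive spaces\<close>

definition ultrafilter :: "'a filter \<Rightarrow> bool" where
  "ultrafilter F \<longleftrightarrow> F \<noteq> bot \<and> (\<forall>P. eventually P F \<or> eventually (\<lambda>x. \<not> P x) F)"

text \<open>Zorn's lemma for proper filters below \<open>F0\<close>, where a smaller filter has more
  eventual properties; the ultrafilters are the minimal ones.\<close>

lemma ultrafilter_exists:
  fixes F0 :: "'a filter"
  assumes "F0 \<noteq> bot"
  obtains F where "ultrafilter F" "F \<le> F0"
proof -
  define S where "S = {F. F \<noteq> bot \<and> F \<le> F0}"
  have "\<exists>m\<in>S. \<forall>F\<in>S. m \<ge> F \<longrightarrow> F = m"
  proof (rule predicate_Zorn)
    show "partial_order_on S (relation_of (\<ge>) S)"
      by (rule partial_order_on_relation_ofI) auto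
    fix C assume "C \<in> Chains (relation_of (\<ge>) S)"
    then have CS: "C \<subseteq> S" and ch: "\<And>F G. F \<in> C \<Longrightarrow> G \<in> C \<Longrightarrow> F \<le> G \<or> G \<le> F"
      by (auto simp: Chains_def relation_of_def)
    show "\<exists>u\<in>S. \<forall>F\<in>C. F \<ge> u"
    proof (cases "C = {}")
      case True
      then show ?thesis using assms by (auto simp: S_def)
    next
      case False
      \<comment> \<open>In a chain every eventual property of the infimum already comes from one
        member, so the infimum stays proper.\<close>
      have "eventually P (Inf C) \<longleftrightarrow> (\<exists>F\<in>C. eventually P F)" for P
        using False ch by (intro eventually_Inf_base) (metis inf.orderE inf_commute order_refl)+
      then have "Inf C \<noteq> bot"
        using CS by (auto simp: trivial_limit_def S_def)
      moreover have "Inf C \<le> F0"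
        using False CS by (metis (mono_tags, lifting) Inf_lower2 S_def ex_in_conv mem_Collect_eq subsetD)
      ultimately show ?thesis
        by (auto simp: S_def intro: Inf_lower)
    qed
  qed
  then obtain F where F: "F \<noteq> bot" "F \<le> F0" and max: "\<And>G. G \<noteq> bot \<Longrightarrow> G \<le> F \<Longrightarrow> G = F"
    unfolding S_def by (auto intro: order_trans)
  have "eventually P F" if "\<not> eventually (\<lambda>x. \<not> P x) F" for P
  proof -
    \<comment> \<open>Restricting \<open>F\<close> to the set where \<open>P\<close> holds leaves a
      proper filter, so by minimality it is \<open>F\<close> itself.\<close>
    have "inf F (principal {x. P x}) \<noteq> bot"
      using that by (simp add: trivial_limit_def eventually_inf_principal)
    then have "inf F (principal {x. P x}) = F"
      by (rule max) simp
    then show ?thesis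
      using eventually_inf_principal[of P F "{x. P x}"] by simp
  qed
  with F show ?thesis
    by (intro that[of F]) (auto simp: ultrafilter_def)
qed

text \<open>Compactness yields a cluster point, and along an ultrafilter a cluster point is a
  limit.\<close>

lemma ultrafilter_tendsto:
  fixes f :: "'a \<Rightarrow> 'b::heine_borel"
  assumes F: "ultrafilter F" and f: "bounded (range f)"
  obtains l where "(f \<longlongrightarrow> l) F"
proof -
  have "compact (closure (range f))"
    using f by (simp add: compact_closure)
  moreover have "filtermap f F \<noteq> bot"
    using F by (simp add: ultrafilter_def filtermap_bot_iff)
  moreover have "eventually (\<lambda>x. x \<in> closure (range f)) (filtermap f F)"
    by (simp add: eventually_filtermap closure_subset[THEN subsetD])
  ultimately obtain l where l: "inf (nhds l) (filtermap f F) \<noteq> bot"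
    unfolding compact_filter by blast
  have "eventually (\<lambda>x. f x \<in> U) F" if U: "open U" "l \<in> U" for U
  proof (rule ccontr)
    assume "\<not> eventually (\<lambda>x. f x \<in> U) F"
    then have "eventually (\<lambda>y. y \<notin> U) (filtermap f F)"
      using F by (auto simp: ultrafilter_def eventually_filtermap)
    moreover have "eventually (\<lambda>y. y \<in> U) (nhds l)"
      using U by (auto simp: eventually_nhds)
    ultimately have "eventually (\<lambda>y. False) (inf (nhds l) (filtermap f F))"
      unfolding eventually_inf by blast
    with l show False by (simp add: trivial_limit_def)
  qed
  then show ?thesis
    by (intro that[of l]) (auto simp: tendsto_def)
qed

text \<open>Weak compactness in ultrafilter form: the limits of \<open>f (u n)\<close> depend
  linearly and boundedly on \<open>f\<close>, so they form an element of the bidual, which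
  reflexivity represents by a vector \<open>w\<close>.\<close>

lemma reflexive_weak_limit:
  fixes u :: "'i \<Rightarrow> 'e::real_normed_vector"
  assumes E: "reflexive_space TYPE('e)" and F: "ultrafilter F" and u: "bounded (range u)"
  obtains w where "\<And>f :: 'e \<Rightarrow>\<^sub>L real. ((\<lambda>n. blinfun_apply f (u n)) \<longlongrightarrow> blinfun_apply f w) F"
proof -
  have nb: "F \<noteq> bot" using F by (simp add: ultrafilter_def)
  obtain B where B: "\<And>n. norm (u n) \<le> B"
    using u by (auto simp: bounded_iff)
  have fB: "norm (blinfun_apply f (u n)) \<le> norm f * B" for f :: "'e \<Rightarrow>\<^sub>L real" and n
    using norm_blinfun[of f "u n"] mult_left_mono[OF B[of n] norm_ge_zero[of f]] by linarith
  define \<phi> where "\<phi> f = Lim F (\<lambda>n. blinfun_apply f (u n))" for f :: "'e \<Rightarrow>\<^sub>L real"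
  have lim: "((\<lambda>n. blinfun_apply f (u n)) \<longlongrightarrow> \<phi> f) F" for f :: "'e \<Rightarrow>\<^sub>L real"
  proof -
    have "bounded (range (\<lambda>n. blinfun_apply f (u n)))"
      using fB by (auto simp: bounded_iff)
    then obtain l where "((\<lambda>n. blinfun_apply f (u n)) \<longlongrightarrow> l) F"
      using ultrafilter_tendsto[OF F] by blast
    then show ?thesis
      using tendsto_Lim[OF nb] by (metis \<phi>_def)
  qed
  have "bounded_linear \<phi>"
  proof (rule bounded_linear_intro)
    fix f g :: "'e \<Rightarrow>\<^sub>L real" and r :: real
    show "\<phi> (f + g) = \<phi> f + \<phi> g"
      using lim[of "f + g"] tendsto_add[OF lim lim, of f g]
      by (intro tendsto_unique[OF nb]) (auto simp: blinfun.add_left)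
    show "\<phi> (r *\<^sub>R f) = r *\<^sub>R \<phi> f"
      using lim[of "r *\<^sub>R f"] tendsto_mult[OF tendsto_const lim, of r f]
      by (intro tendsto_unique[OF nb]) (auto simp: blinfun.scaleR_left)
    show "norm (\<phi> f) \<le> norm f * B"
      using fB by (intro tendsto_upperbound[OF tendsto_norm[OF lim] _ nb]) auto
  qed
  then have "blinfun_apply (Blinfun \<phi>) = \<phi>"
    by (rule bounded_linear_Blinfun_apply)
  moreover obtain w where "\<And>f. blinfun_apply (Blinfun \<phi>) f = blinfun_apply f w"
    using E unfolding reflexive_space_def by blast
  ultimately show ?thesis
    using lim by (intro that[of w]) metis
qed

text \<open>The weak limits exist vector by vector. Functionals separate points, which gives
  linearity in \<open>v\<close>; a norming functional at the limit gives the norm bound.\<close>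

lemma reflexive_weak_operator_limit:
  fixes T :: "'i \<Rightarrow> 'e::real_normed_vector \<Rightarrow>\<^sub>L 'e"
  assumes E: "reflexive_space TYPE('e)" and F: "ultrafilter F"
    and T: "\<And>n v. norm (blinfun_apply (T n) v) \<le> norm v"
  obtains P :: "'e \<Rightarrow>\<^sub>L 'e" where "\<And>(f :: 'e \<Rightarrow>\<^sub>L real) v.
    ((\<lambda>n. blinfun_apply f (blinfun_apply (T n) v)) \<longlongrightarrow> blinfun_apply f (blinfun_apply P v)) F"
proof -
  have nb: "F \<noteq> bot" using F by (simp add: ultrafilter_def)
  have "\<exists>w. \<forall>f :: 'e \<Rightarrow>\<^sub>L real. ((\<lambda>n. blinfun_apply f (blinfun_apply (T n) v)) \<longlongrightarrow> blinfun_apply f w) F" for v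
  proof -
    have "bounded (range (\<lambda>n. blinfun_apply (T n) v))"
      using T by (auto simp: bounded_iff)
    then show ?thesis
      using reflexive_weak_limit[OF E F] by metis
  qed
  then obtain p where p: "\<And>v f. ((\<lambda>n. blinfun_apply f (blinfun_apply (T n) v)) \<longlongrightarrow> blinfun_apply (f :: 'e \<Rightarrow>\<^sub>L real) (p v)) F"
    by metis
  have "bounded_linear p"
  proof (rule bounded_linear_intro)
    fix v w :: 'e and r :: real
    show "p (v + w) = p v + p w"
    proof (rule blinfun_separates)
      fix f :: "'e \<Rightarrow>\<^sub>L real"
      show "blinfun_apply f (p (v + w)) = blinfun_apply f (p v + p w)"
        using p[of f "v + w"] tendsto_add[OF p p, of f v f w]
        by (intro tendsto_unique[OF nb]) (auto simp: blinfun.add_right)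
    qed
    show "p (r *\<^sub>R v) = r *\<^sub>R p v"
    proof (rule blinfun_separates)
      fix f :: "'e \<Rightarrow>\<^sub>L real"
      show "blinfun_apply f (p (r *\<^sub>R v)) = blinfun_apply f (r *\<^sub>R p v)"
        using p[of f "r *\<^sub>R v"] tendsto_mult[OF tendsto_const p, of r f v]
        by (intro tendsto_unique[OF nb]) (auto simp: blinfun.scaleR_right)
    qed
    obtain f :: "'e \<Rightarrow>\<^sub>L real" where f: "norm f \<le> 1" "blinfun_apply f (p v) = norm (p v)"
      by (rule norming_functional)
    have "blinfun_apply f (blinfun_apply (T n) v) \<le> norm v" for n
      using norm_blinfun[of f "blinfun_apply (T n) v"] T[of n v]
        mult_right_mono[OF f(1) norm_ge_zero[of "blinfun_apply (T n) v"]] by simp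
    then show "norm (p v) \<le> norm v * 1"
      using tendsto_upperbound[OF p[of f v] _ nb, of "norm v"] f(2) by simp
  qed
  then show ?thesis
    using p by (intro that[of "Blinfun p"]) (simp add: bounded_linear_Blinfun_apply)
qed

section \<open>Points of weak-to-norm continuity\<close>

lemma countable_sum_list_lists:
  "countable C \<Longrightarrow> countable (sum_list ` lists (C :: 'a::monoid_add set))"
  by (simp add: countable_lists)

lemma subspace_closure:
  fixes S :: "'a::real_normed_vector set"
  assumes "subspace S"
  shows "subspace (closure S)"
  unfolding subspace_def
proof (intro conjI ballI allI)
  show "0 \<in> closure S"
    using subspace_0[OF assms] closure_subset by blast
  fix x y and c :: real assume "x \<in> closure S"
  then obtain a where a: "\<And>n. a n \<in> S" "a \<longlonglongrightarrow> x"
    unfolding closure_sequential by blast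
  have "(\<lambda>n. c *\<^sub>R a n) \<longlonglongrightarrow> c *\<^sub>R x"
    using a(2) by (intro tendsto_intros)
  then show "c *\<^sub>R x \<in> closure S"
    unfolding closure_sequential
    by (intro exI[of _ "\<lambda>n. c *\<^sub>R a n"] conjI allI subspace_scale[OF assms] a(1))
  assume "y \<in> closure S"
  then obtain b where b: "\<And>n. b n \<in> S" "b \<longlonglongrightarrow> y"
    unfolding closure_sequential by blast
  show "x + y \<in> closure S"
    unfolding closure_sequential
    by (intro exI[of _ "\<lambda>n. a n + b n"] conjI allI subspace_add[OF assms] tendsto_add a b)
qed

text \<open>\<open>C\<close> consists of the finite sums of rational multiples of elements of
  \<open>D\<close>; writing them as sums of lists makes countability immediate.\<close>

lemma countable_dense_in_span:
  fixes D :: "'a::real_normed_vector set"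
  assumes "countable D"
  obtains C where "countable C" "C \<noteq> {}" "span D \<subseteq> closure C"
proof -
  define G where "G = (\<lambda>(q::rat, d). of_rat q *\<^sub>R d) ` (UNIV \<times> D)"
  define C where "C = sum_list ` lists G"
  have "countable G"
    using assms by (simp add: G_def)
  then have "countable C"
    by (simp add: C_def countable_sum_list_lists)
  moreover have 0: "0 \<in> C"
    unfolding C_def by (rule image_eqI[of _ _ "[]"]) auto
  moreover have "span D \<subseteq> closure C"
  proof
    fix x assume "x \<in> span D"
    then show "x \<in> closure C"
    proof (induction rule: span_induct_alt)
      case base
      then show ?case using 0 closure_subset by blast
    next
      case (step r d y)
      show ?case unfolding closure_approachable
      proof safe
        fix e :: real assume e: "e > 0"
        obtain c where c: "c \<in> C" "dist c y < e / 2"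
          using step(2) e unfolding closure_approachable by (metis half_gt_zero)
        \<comment> \<open>Tolerance for the rational coefficient; the summand 1 keeps the
          denominator positive when \<open>d\<close> is 0.\<close>
        have "e / 2 / (norm d + 1) > 0"
          using e by (simp add: add_nonneg_pos)
        then obtain q where q: "r < of_rat q" "of_rat q < r + e / 2 / (norm d + 1)"
          using of_rat_dense[where x = r and y = "r + e / 2 / (norm d + 1)"] by auto
        obtain l where l: "l \<in> lists G" "c = sum_list l"
          using c(1) by (auto simp: C_def)
        have "of_rat q *\<^sub>R d + c \<in> C"
          unfolding C_def using l step(1)
          by (intro image_eqI[of _ _ "of_rat q *\<^sub>R d # l"]) (auto simp: G_def)
        moreover have "dist (of_rat q *\<^sub>R d + c) (r *\<^sub>R d + y) < e"
        proof -
          have "\<bar>of_rat q - r\<bar> * norm d \<le> e / 2 / (norm d + 1) * (norm d + 1)"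
            using q by (intro mult_mono) auto
          moreover have "norm d + 1 \<noteq> 0"
            using norm_ge_zero[of d] by linarith
          ultimately have "\<bar>of_rat q - r\<bar> * norm d \<le> e / 2"
            by (metis nonzero_eq_divide_eq)
          moreover have "dist (of_rat q *\<^sub>R d + c) (r *\<^sub>R d + y) \<le> norm ((of_rat q - r) *\<^sub>R d) + dist c y"
            using norm_triangle_ineq[of "(of_rat q - r) *\<^sub>R d" "c - y"]
            by (simp add: dist_norm algebra_simps)
          ultimately show ?thesis using c(2) by simp
        qed
        ultimately show "\<exists>y'\<in>C. dist y' (r *\<^sub>R d + y) < e" by blast
      qed
    qed
  qed
  ultimately show ?thesis using that by blast
qed

text \<open>This is the Baire category argument for the weak topology, unfolded: otherwise one can move
  inside \<open>A\<close>, keeping all earlier strict inequalities, away from each member of a dense sequence,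
  and record this by a norming functional; a weak limit then has positive distance from the dense
  sequence.\<close>

lemma reflexive_small_weakly_open_piece:
  fixes A :: "'e::real_normed_vector set"
  assumes E: "reflexive_space TYPE('e)"
    and A: "A \<noteq> {}" "bounded A" "A \<subseteq> closure (span D)" and D: "countable D" and \<delta>: "\<delta> > 0"
  obtains u and W :: "(('e \<Rightarrow>\<^sub>L real) \<times> real) set"
  where "u \<in> A" "finite W" "\<forall>(f, c)\<in>W. c < blinfun_apply f u"
    "\<And>u'. u' \<in> A \<Longrightarrow> \<forall>(f, c)\<in>W. c < blinfun_apply f u' \<Longrightarrow> norm (u' - u) \<le> \<delta>"
proof (rule ccontr)
  assume contra: "\<not> thesis"
  note witness = that
  have move: "\<exists>u'\<in>A. (\<forall>(f, c)\<in>W. c < blinfun_apply f u') \<and> \<delta> < norm (u' - u)"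
    if u: "u \<in> A" "finite W" "\<forall>(f, c)\<in>W. c < blinfun_apply f u" for u and W :: "(('e \<Rightarrow>\<^sub>L real) \<times> real) set"
  proof (rule ccontr)
    assume no: "\<not> ?thesis"
    have "norm (u' - u) \<le> \<delta>" if "u' \<in> A" "\<forall>(f, c)\<in>W. c < blinfun_apply f u'" for u'
      using no that by (meson not_le_imp_less)
    then show False
      using witness[OF u] contra by blast
  qed
  obtain C where C: "countable C" "C \<noteq> {}" "span D \<subseteq> closure C"
    by (rule countable_dense_in_span[OF D])
  define d where "d = from_nat_into C"
  \<comment> \<open>A state is a point of \<open>A\<close> together with the finitely many strict
    inequalities imposed so far, all satisfied by the point.\<close>
  define good where "good s \<longleftrightarrow> fst s \<in> A \<and> finite (snd s) \<and> (\<forall>(f, c)\<in>snd s. c < blinfun_apply f (fst s))"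
    for s :: "'e \<times> (('e \<Rightarrow>\<^sub>L real) \<times> real) set"
  define step where "step n s s' \<longleftrightarrow> snd s \<subseteq> snd s' \<and>
      (\<exists>f. norm f \<le> 1 \<and> (f, blinfun_apply f (d n) + \<delta> / 2) \<in> snd s')"
    for n and s s' :: "'e \<times> (('e \<Rightarrow>\<^sub>L real) \<times> real) set"
  have "\<exists>s. \<forall>n. good (s n) \<and> step n (s n) (s (Suc n))"
  proof (rule dependent_nat_choice)
    show "\<exists>s. good s"
      using A(1) by (auto simp: good_def intro!: exI[of _ "{}"])
    fix s n assume s: "good s"
    then obtain u' where u': "u' \<in> A" "\<forall>(f, c)\<in>snd s. c < blinfun_apply f u'" "\<delta> < norm (u' - fst s)"
      using move[of "fst s" "snd s"] unfolding good_def by blast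
    \<comment> \<open>Two points more than \<delta> apart cannot both lie within \<delta>/2 of
      \<open>d n\<close>, so the new point or the old one serves as \<open>v\<close>.\<close>
    have "norm (u' - fst s) \<le> norm (u' - d n) + norm (fst s - d n)"
      using norm_triangle_ineq4[of "u' - d n" "fst s - d n"] by simp
    then obtain v where v: "v \<in> A" "\<forall>(f, c)\<in>snd s. c < blinfun_apply f v" "\<delta> / 2 < norm (v - d n)"
      using u' s unfolding good_def by (cases "\<delta> / 2 < norm (u' - d n)") fastforce+
    obtain f :: "'e \<Rightarrow>\<^sub>L real" where f: "norm f \<le> 1" "blinfun_apply f (v - d n) = norm (v - d n)"
      by (rule norming_functional)
    have "blinfun_apply f (d n) + \<delta> / 2 < blinfun_apply f v"
      using f(2) v(3) by (simp add: blinfun.diff_right)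
    then show "\<exists>s'. good s' \<and> step n s s'"
      using s v f(1) by (intro exI[of _ "(v, insert (f, blinfun_apply f (d n) + \<delta> / 2) (snd s))"])
        (auto simp: good_def step_def)
  qed
  then obtain s where s: "\<And>n. good (s n)" "\<And>n. step n (s n) (s (Suc n))" by blast
  define u where "u n = fst (s n)" for n
  have uA: "u n \<in> A" for n using s(1)[of n] by (simp add: good_def u_def)
  have mono: "snd (s m) \<subseteq> snd (s n)" if "m \<le> n" for m n
    using that
  proof (induction rule: dec_induct)
    case (step n)
    then show ?case using s(2)[of n] unfolding step_def by blast
  qed simp
  obtain F :: "nat filter" where F: "ultrafilter F" "F \<le> sequentially"
    by (rule ultrafilter_exists[OF sequentially_bot])
  have nb: "F \<noteq> bot" using F by (simp add: ultrafilter_def)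
  have "bounded (range u)" using uA by (intro bounded_subset[OF A(2)]) auto
  then obtain w where w: "\<And>f :: 'e \<Rightarrow>\<^sub>L real. ((\<lambda>n. blinfun_apply f (u n)) \<longlongrightarrow> blinfun_apply f w) F"
    using reflexive_weak_limit[OF E F(1)] by blast
  \<comment> \<open>The inequality imposed at step \<open>n\<close> holds at all later points, so it
    survives, no longer strict, at the weak limit.\<close>
  have far: "\<delta> / 2 \<le> norm (w - d n)" for n
  proof -
    obtain f where f: "norm f \<le> 1" "(f, blinfun_apply f (d n) + \<delta> / 2) \<in> snd (s (Suc n))"
      using s(2)[of n] by (auto simp: step_def)
    have "blinfun_apply f (d n) + \<delta> / 2 \<le> blinfun_apply f (u m)" if "m \<ge> Suc n" for m
      using mono[OF that] f(2) s(1)[of m] by (force simp: good_def u_def)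
    then have "eventually (\<lambda>m. blinfun_apply f (d n) + \<delta> / 2 \<le> blinfun_apply f (u m)) F"
      by (intro filter_leD[OF F(2)] eventually_sequentiallyI)
    then have "blinfun_apply f (d n) + \<delta> / 2 \<le> blinfun_apply f w"
      by (rule tendsto_lowerbound[OF w _ nb])
    then have "\<delta> / 2 \<le> blinfun_apply f (w - d n)"
      by (simp add: blinfun.diff_right)
    also have "\<dots> \<le> norm f * norm (w - d n)"
      using norm_blinfun[of f "w - d n"] by simp
    also have "\<dots> \<le> norm (w - d n)"
      using mult_right_mono[OF f(1) norm_ge_zero[of "w - d n"]] by simp
    finally show ?thesis .
  qed
  \<comment> \<open>A norm closed subspace is weakly closed, by a separating functional. Hence
    \<open>w\<close> is near some \<open>d n\<close>, contradicting \<open>far\<close>.\<close>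
  have "w \<in> closure (span D)"
  proof (rule ccontr)
    assume "w \<notin> closure (span D)"
    then obtain f :: "'e \<Rightarrow>\<^sub>L real" where f: "\<And>v. v \<in> closure (span D) \<Longrightarrow> blinfun_apply f v = 0" "blinfun_apply f w > 0"
      using separating_functional[of "closure (span D)" w] by (auto simp: subspace_closure)
    then have "(\<lambda>n. blinfun_apply f (u n)) = (\<lambda>n. 0)"
      using uA A(3) by auto
    with w[of f] have "blinfun_apply f w = 0"
      using tendsto_unique[OF nb, of "\<lambda>n. 0"] by auto
    with f(2) show False by simp
  qed
  then have "w \<in> closure C"
    using closure_mono[OF C(3)] by auto
  then obtain c where "c \<in> C" "dist c w < \<delta> / 2"
    using \<delta> unfolding closure_approachable by (metis half_gt_zero)
  moreover then obtain n where "c = d n"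
    using from_nat_into_surj[OF C(1)] unfolding d_def by metis
  ultimately show False
    using far[of n] by (simp add: dist_norm norm_minus_commute)
qed

section \<open>Isometric representations of \<open>c0\<close> on reflexive spaces\<close>

definition summing :: "nat \<Rightarrow> nat \<Rightarrow>\<^sub>C real" where
  "summing n = Bcontfun (\<lambda>i. if i \<le> n then 1 else 0)"

lemma apply_summing: "apply_bcontfun (summing n) i = (if i \<le> n then 1 else 0)"
proof -
  have "bounded (range (\<lambda>i. if i \<le> n then 1 else 0 :: real))"
    by (auto simp: bounded_iff intro!: exI[of _ 1])
  then have "(\<lambda>i. if i \<le> n then 1 else 0 :: real) \<in> bcontfun"
    by (simp add: bcontfun_def)
  then show ?thesis
    by (simp add: summing_def Bcontfun_inverse)
qed

lemma finite_support_c0: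
  assumes "\<And>i. M < i \<Longrightarrow> apply_bcontfun x i = 0"
  shows "x \<in> c0"
  unfolding c0_def using assms
  by (auto intro!: tendsto_eventually eventually_sequentiallyI[of "Suc M"])

lemma scaleR_summing_c0: "c *\<^sub>R summing n \<in> c0"
  by (rule finite_support_c0[of n]) (simp add: apply_summing)

text \<open>The rational span of the summing basis. Being countable it has countable orbits, as the
  small weakly open pieces require, and it contains the sums built from steps of size 1/k.\<close>

definition summing_lattice :: "(nat \<Rightarrow>\<^sub>C real) set" where
  "summing_lattice = sum_list ` lists (range (\<lambda>(q::rat, n). of_rat q *\<^sub>R summing n))"

lemma countable_summing_lattice: "countable summing_lattice"
  by (simp add: summing_lattice_def countable_sum_list_lists)

lemma zero_summing_lattice: "0 \<in> summing_lattice"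
  unfolding summing_lattice_def by (rule image_eqI[of _ _ "[]"]) auto

lemma add_summing_lattice: "x \<in> summing_lattice \<Longrightarrow> y \<in> summing_lattice \<Longrightarrow> x + y \<in> summing_lattice"
  unfolding summing_lattice_def
  by (auto simp del: sum_list_append simp flip: sum_list_append intro!: imageI)

lemma scaleR_summing_lattice: "of_rat q *\<^sub>R summing n \<in> summing_lattice"
  unfolding summing_lattice_def by (rule image_eqI[of _ _ "[of_rat q *\<^sub>R summing n]"]) auto

lemma summing_lattice_subset_c0: "summing_lattice \<subseteq> c0"
proof -
  have "sum_list l \<in> c0" if "l \<in> lists (range (\<lambda>(q::rat, n). of_rat q *\<^sub>R summing n))" for l
    using that
    by (induction l) (auto simp: subspace_0[OF subspace_c0] intro!: subspace_add[OF subspace_c0] scaleR_summing_c0)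
  then show ?thesis by (auto simp: summing_lattice_def)
qed

lemma norm_bcontfun_le_iff: "norm x \<le> c \<longleftrightarrow> (\<forall>i. \<bar>apply_bcontfun x i\<bar> \<le> c)"
  for x :: "nat \<Rightarrow>\<^sub>C real"
  using norm_bounded[of x] by (auto intro: order_trans norm_bound)

lemma tendsto_abs_diff_bound:
  fixes g :: "'i \<Rightarrow> real"
  assumes "F \<noteq> bot" "(g \<longlongrightarrow> l) F" "eventually (\<lambda>n. \<bar>g n - c\<bar> \<le> b) F"
  shows "\<bar>l - c\<bar> \<le> b"
  using assms by (intro tendsto_upperbound[OF tendsto_rabs[OF tendsto_diff[OF assms(2) tendsto_const]]])

text \<open>Identifies the interlaced product with the separated one.\<close>

lemma funpow_comp_commute:
  assumes "\<And>x. p (q x) = q (p x)"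
  shows "((\<lambda>x. p (q x)) ^^ j) x = (q ^^ j) ((p ^^ j) x)"
proof (induction j)
  case (Suc j)
  have "p ((q ^^ j) y) = (q ^^ j) (p y)" for y
    by (induction j) (simp_all add: assms)
  with Suc show ?case by (simp add: assms)
qed simp

text \<open>What a representation provides at the level of vectors. The guards are there because
  \<open>h\<close> is a total function whose values outside \<open>c0\<close> are arbitrary. The
  conclusion \<open>far_strongly_close\<close> will contradict openness of \<open>h\<close> onto its
  image.\<close>

locale c0_representation =
  fixes h :: "(nat \<Rightarrow>\<^sub>C real) \<Rightarrow> 'e::real_normed_vector \<Rightarrow>\<^sub>L 'e"
  assumes reflexive: "reflexive_space TYPE('e)"
    and zero: "blinfun_apply (h 0) v = v"
    and add: "x \<in> c0 \<Longrightarrow> y \<in> c0 \<Longrightarrow> blinfun_apply (h (x + y)) v = blinfun_apply (h x) (blinfun_apply (h y) v)"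
    and isometric: "x \<in> c0 \<Longrightarrow> norm (blinfun_apply (h x) v) = norm v"
    and continuous: "\<eta> > 0 \<Longrightarrow> \<exists>\<rho>>0. \<forall>x\<in>c0. norm x \<le> \<rho> \<longrightarrow> norm (blinfun_apply (h x) v - v) \<le> \<eta>"
begin

text \<open>\<open>wot_adherent T X\<close>: the map \<open>T\<close> lies in the closure of \<open>h ` X\<close> for the weak operator topology.\<close>

definition wot_adherent :: "('e \<Rightarrow> 'e) \<Rightarrow> (nat \<Rightarrow>\<^sub>C real) set \<Rightarrow> bool" where
  "wot_adherent T X \<longleftrightarrow> (\<forall>G :: (('e \<Rightarrow>\<^sub>L real) \<times> 'e) set. \<forall>e>0. finite G \<longrightarrow>
     (\<exists>x\<in>X. \<forall>(f, v)\<in>G. \<bar>blinfun_apply f (blinfun_apply (h x) v) - blinfun_apply f (T v)\<bar> < e))"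

lemma wot_adherentD:
  fixes G :: "(('e \<Rightarrow>\<^sub>L real) \<times> 'e) set"
  assumes "wot_adherent T X" "finite G" "e > 0"
  obtains x where "x \<in> X"
    "\<And>f v. (f, v) \<in> G \<Longrightarrow> \<bar>blinfun_apply f (blinfun_apply (h x) v) - blinfun_apply f (T v)\<bar> < e"
proof -
  obtain x where "x \<in> X"
    "\<forall>(f, v)\<in>G. \<bar>blinfun_apply f (blinfun_apply (h x) v) - blinfun_apply f (T v)\<bar> < e"
    using assms unfolding wot_adherent_def by blast
  then show ?thesis by (intro that) auto
qed

lemma wot_adherent_mono: "wot_adherent T X \<Longrightarrow> X \<subseteq> Y \<Longrightarrow> wot_adherent T Y"
  unfolding wot_adherent_def by (intro allI impI) (elim allE impE, assumption+, blast)

lemma wot_adherent_limit: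
  assumes F: "F \<noteq> bot" and X: "eventually (\<lambda>n. x n \<in> X) F"
    and lim: "\<And>(f :: 'e \<Rightarrow>\<^sub>L real) v. ((\<lambda>n. blinfun_apply f (blinfun_apply (h (x n)) v)) \<longlongrightarrow> blinfun_apply f (T v)) F"
  shows "wot_adherent T X"
  unfolding wot_adherent_def
proof (intro allI impI)
  fix G :: "(('e \<Rightarrow>\<^sub>L real) \<times> 'e) set" and e :: real
  assume G: "finite G" and e: "e > 0"
  have "eventually (\<lambda>n. \<forall>(f, v)\<in>G. \<bar>blinfun_apply f (blinfun_apply (h (x n)) v) - blinfun_apply f (T v)\<bar> < e) F"
  proof (rule eventually_ball_finite[OF G], clarify)
    fix f :: "'e \<Rightarrow>\<^sub>L real" and v
    show "eventually (\<lambda>n. \<bar>blinfun_apply f (blinfun_apply (h (x n)) v) - blinfun_apply f (T v)\<bar> < e) F"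
      using tendstoD[OF lim e, of f v] by (simp add: dist_real_def)
  qed
  from eventually_happens'[OF F eventually_conj[OF X this]]
  show "\<exists>x\<in>X. \<forall>(f, v)\<in>G. \<bar>blinfun_apply f (blinfun_apply (h x) v) - blinfun_apply f (T v)\<bar> < e"
    by blast
qed

text \<open>Composition is not jointly continuous for the weak operator topology, so
  \<open>x\<close> is chosen first, to approximate \<open>S\<close> at the vectors
  \<open>T v\<close>, and then \<open>y\<close>, against the functionals
  \<open>f o\<^sub>L h x\<close>. This order lets \<open>Y\<close> depend on
  \<open>x\<close>.\<close>

lemma wot_adherent_comp:
  assumes S: "wot_adherent S X" and T: "\<And>x. x \<in> X \<Longrightarrow> wot_adherent T (Y x)"
    and sub: "X \<subseteq> c0" "\<And>x. x \<in> X \<Longrightarrow> Y x \<subseteq> c0"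
  shows "wot_adherent (\<lambda>v. S (T v)) {x + y | x y. x \<in> X \<and> y \<in> Y x}"
  unfolding wot_adherent_def
proof (intro allI impI)
  fix G :: "(('e \<Rightarrow>\<^sub>L real) \<times> 'e) set" and e :: real
  assume G: "finite G" and e: "e > 0"
  obtain x where x: "x \<in> X" and
    "\<And>f v. (f, v) \<in> (\<lambda>(f, v). (f, T v)) ` G \<Longrightarrow> \<bar>blinfun_apply f (blinfun_apply (h x) v) - blinfun_apply f (S v)\<bar> < e / 2"
    using wot_adherentD[OF S finite_imageI[OF G] half_gt_zero[OF e]] by blast
  then have 1: "\<bar>blinfun_apply f (blinfun_apply (h x) (T v)) - blinfun_apply f (S (T v))\<bar> < e / 2"
    if "(f, v) \<in> G" for f v
    using that by force
  obtain y where y: "y \<in> Y x" and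
    "\<And>f v. (f, v) \<in> (\<lambda>(f, v). (f o\<^sub>L h x, v)) ` G \<Longrightarrow> \<bar>blinfun_apply f (blinfun_apply (h y) v) - blinfun_apply f (T v)\<bar> < e / 2"
    using wot_adherentD[OF T[OF x] finite_imageI[OF G] half_gt_zero[OF e]] by blast
  then have 2: "\<bar>blinfun_apply (f o\<^sub>L h x) (blinfun_apply (h y) v) - blinfun_apply (f o\<^sub>L h x) (T v)\<bar> < e / 2"
    if "(f, v) \<in> G" for f v
    using that by force
  have "\<bar>blinfun_apply f (blinfun_apply (h (x + y)) v) - blinfun_apply f (S (T v))\<bar> < e"
    if "(f, v) \<in> G" for f v
  proof -
    have xy: "x \<in> c0" "y \<in> c0"
      using x y sub by blast+
    show ?thesis
      using 1[OF that] 2[OF that] unfolding blinfun_apply_blinfun_compose add[OF xy] by linarith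
  qed
  then show "\<exists>z\<in>{x + y | x y. x \<in> X \<and> y \<in> Y x}.
      \<forall>(f, v)\<in>G. \<bar>blinfun_apply f (blinfun_apply (h z) v) - blinfun_apply f (S (T v))\<bar> < e"
    using x y by blast
qed

text \<open>Captures the sums of \<open>j\<close> terms \<open>c *\<^sub>R summing n\<close> with
  all n \<ge> N. The parameter \<open>N\<close> lets one block stay constant beyond the support of
  an earlier one.\<close>

definition block :: "real \<Rightarrow> nat \<Rightarrow> nat \<Rightarrow> (nat \<Rightarrow>\<^sub>C real) set" where
  "block c j N = {x \<in> summing_lattice. (\<forall>i\<le>N. apply_bcontfun x i = c * real j) \<and>
     (\<exists>M. \<forall>i>M. apply_bcontfun x i = 0)}"

lemma block_subset_c0: "block c j N \<subseteq> c0"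
  using summing_lattice_subset_c0 by (auto simp: block_def)

text \<open>Each factor \<open>p\<close> contributes one term
  \<open>of_rat q *\<^sub>R summing n\<close>, and since \<open>F\<close> refines
  \<open>sequentially\<close> only n \<ge> N matter.\<close>

lemma wot_adherent_block:
  assumes F: "F \<noteq> bot" "F \<le> sequentially"
    and lim: "\<And>(f :: 'e \<Rightarrow>\<^sub>L real) v.
      ((\<lambda>n. blinfun_apply f (blinfun_apply (h (of_rat q *\<^sub>R summing n)) v)) \<longlongrightarrow> blinfun_apply f (p v)) F"
  shows "wot_adherent (p ^^ j) (block (of_rat q) j N)"
proof (induction j)
  case 0
  have "0 \<in> block (of_rat q) 0 N"
    by (simp add: block_def zero_summing_lattice)
  then show ?case
    unfolding wot_adherent_def by (auto simp: zero intro!: bexI[of _ 0])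
next
  case (Suc j)
  define X where "X = {of_rat q *\<^sub>R summing n | n. n \<ge> N}"
  have "wot_adherent p X"
  proof (rule wot_adherent_limit[OF F(1) _ lim])
    show "eventually (\<lambda>n. of_rat q *\<^sub>R summing n \<in> X) F"
      by (intro filter_leD[OF F(2)] eventually_sequentiallyI[of N]) (auto simp: X_def)
  qed
  then have "wot_adherent (\<lambda>v. p ((p ^^ j) v)) {x + y | x y. x \<in> X \<and> y \<in> block (of_rat q) j N}"
    using Suc block_subset_c0 by (intro wot_adherent_comp) (auto simp: X_def scaleR_summing_c0)
  moreover have "x + y \<in> block (of_rat q) (Suc j) N" if xy: "x \<in> X" "y \<in> block (of_rat q) j N" for x y
  proof -
    obtain n where n: "n \<ge> N" "x = of_rat q *\<^sub>R summing n"
      using xy(1) by (auto simp: X_def)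
    obtain M where M: "\<And>i. i > M \<Longrightarrow> apply_bcontfun y i = 0"
      using xy(2) by (auto simp: block_def)
    have "apply_bcontfun (x + y) i = 0" if "i > max M n" for i
      using that M[of i] by (simp add: n apply_summing)
    moreover have "apply_bcontfun (x + y) i = of_rat q * real (Suc j)" if "i \<le> N" for i
      using that xy(2) n by (simp add: block_def apply_summing algebra_simps)
    moreover have "x + y \<in> summing_lattice"
      using xy(2) by (simp add: n block_def add_summing_lattice scaleR_summing_lattice)
    ultimately show ?thesis
      unfolding block_def by blast
  qed
  ultimately show ?case
    by (auto elim!: wot_adherent_mono)
qed

text \<open>In the sums \<open>z + \<epsilon> (summing n1 - summing m1) + \<epsilon> (summing n2 - summing m2) + \<dots>\<close> with interlaced
  indices \<open>n1 < m1 < n2 < \<dots>\<close> the increments are disjointly supported, so the norm never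
  exceeds \<open>\<epsilon>\<close>.\<close>

lemma interlaced_limit_close:
  assumes F: "F \<noteq> bot" "F \<le> sequentially"
    and p: "\<And>(f :: 'e \<Rightarrow>\<^sub>L real) v.
      ((\<lambda>n. blinfun_apply f (blinfun_apply (h (\<epsilon> *\<^sub>R summing n)) v)) \<longlongrightarrow> blinfun_apply f (p v)) F"
    and q: "\<And>(f :: 'e \<Rightarrow>\<^sub>L real) v.
      ((\<lambda>n. blinfun_apply f (blinfun_apply (h (- \<epsilon> *\<^sub>R summing n)) v)) \<longlongrightarrow> blinfun_apply f (q v)) F"
    and \<epsilon>: "\<epsilon> \<ge> 0"
    and close: "\<And>x. x \<in> c0 \<Longrightarrow> norm x \<le> \<epsilon> \<Longrightarrow> norm (blinfun_apply (h x) v - v) \<le> \<eta>"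
    and z: "norm z \<le> \<epsilon>" "\<And>i. i > M \<Longrightarrow> apply_bcontfun z i = 0"
  shows "\<bar>blinfun_apply f (blinfun_apply (h z) (((\<lambda>v. p (q v)) ^^ j) v)) - blinfun_apply f v\<bar> \<le> norm f * \<eta>"
  using z
proof (induction j arbitrary: z M)
  case 0
  have "\<bar>blinfun_apply f (blinfun_apply (h z) v - v)\<bar> \<le> norm f * norm (blinfun_apply (h z) v - v)"
    using norm_blinfun[of f] by auto
  also have "\<dots> \<le> norm f * \<eta>"
    using close 0 finite_support_c0 by (intro mult_left_mono) auto
  finally show ?case by (simp add: blinfun.diff_right)
next
  case (Suc j)
  let ?w = "((\<lambda>v. p (q v)) ^^ j) v"
  have zc: "z \<in> c0" using Suc.prems(2) finite_support_c0 by blast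
  \<comment> \<open>The outer limit fixes \<open>n\<close> beyond the support of \<open>z\<close>;
    then \<open>m\<close> runs to infinity against the fixed functional
    \<open>f o\<^sub>L h (z + \<epsilon> *\<^sub>R summing n)\<close>. The induction hypothesis
    applies to the enlarged vector, with \<open>m\<close> as its new support bound.\<close>
  have inner: "\<bar>blinfun_apply f (blinfun_apply (h z) (blinfun_apply (h (\<epsilon> *\<^sub>R summing n)) (q ?w))) - blinfun_apply f v\<bar> \<le> norm f * \<eta>"
    if n: "n > M" for n
  proof -
    let ?g = "f o\<^sub>L h (z + \<epsilon> *\<^sub>R summing n)"
    have "\<bar>blinfun_apply ?g (q ?w) - blinfun_apply f v\<bar> \<le> norm f * \<eta>"
    proof (rule tendsto_abs_diff_bound[OF F(1) q])
      have "\<bar>blinfun_apply ?g (blinfun_apply (h (- \<epsilon> *\<^sub>R summing m)) ?w) - blinfun_apply f v\<bar> \<le> norm f * \<eta>"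
        if m: "m \<ge> n" for m
      proof -
        let ?z = "z + \<epsilon> *\<^sub>R summing n + - \<epsilon> *\<^sub>R summing m"
        have zi: "\<bar>apply_bcontfun z i\<bar> \<le> \<epsilon>" for i
          using Suc.prems(1) norm_bcontfun_le_iff by blast
        \<comment> \<open>The increment is -\<epsilon> on the indices i with n < i \<le> m and 0
          elsewhere, while \<open>z\<close> vanishes beyond M < n.\<close>
        have "norm ?z \<le> \<epsilon>"
          unfolding norm_bcontfun_le_iff
        proof
          fix i
          show "\<bar>apply_bcontfun ?z i\<bar> \<le> \<epsilon>"
            using zi[of i] Suc.prems(2)[of i] \<epsilon> m n by (cases "i > M") (auto simp: apply_summing)
        qed
        moreover have "apply_bcontfun ?z i = 0" if "i > m" for i
          using that m n Suc.prems(2)[of i] by (simp add: apply_summing)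
        ultimately have "\<bar>blinfun_apply f (blinfun_apply (h ?z) ?w) - blinfun_apply f v\<bar> \<le> norm f * \<eta>"
          by (rule Suc.IH)
        then show ?thesis
          using add[of "z + \<epsilon> *\<^sub>R summing n" "- \<epsilon> *\<^sub>R summing m" ?w] scaleR_summing_c0 zc
            subspace_add[OF subspace_c0] by (simp del: scaleR_minus_left)
      qed
      then show "eventually (\<lambda>m. \<bar>blinfun_apply ?g (blinfun_apply (h (- \<epsilon> *\<^sub>R summing m)) ?w) - blinfun_apply f v\<bar> \<le> norm f * \<eta>) F"
        by (intro filter_leD[OF F(2)] eventually_sequentiallyI)
    qed
    then show ?thesis
      using add[OF zc scaleR_summing_c0] by simp
  qed
  have "\<bar>blinfun_apply (f o\<^sub>L h z) (p (q ?w)) - blinfun_apply f v\<bar> \<le> norm f * \<eta>"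
    using inner by (intro tendsto_abs_diff_bound[OF F(1) p] filter_leD[OF F(2)] eventually_sequentiallyI[of "Suc M"]) auto
  then show ?case by simp
qed

lemma commute: "x \<in> c0 \<Longrightarrow> y \<in> c0 \<Longrightarrow>
    blinfun_apply (h x) (blinfun_apply (h y) v) = blinfun_apply (h y) (blinfun_apply (h x) v)"
  by (metis add add.commute)

text \<open>One limit at a time: \<open>P\<close> commutes with every \<open>h z\<close> because
  \<open>f o\<^sub>L h z\<close> is a functional, and then with \<open>Q\<close> because
  \<open>f o\<^sub>L P\<close> is one.\<close>

lemma wot_limits_commute:
  fixes P Q :: "'e \<Rightarrow>\<^sub>L 'e"
  assumes F: "F \<noteq> bot"
    and P: "\<And>(f :: 'e \<Rightarrow>\<^sub>L real) v. ((\<lambda>n. blinfun_apply f (blinfun_apply (h (x n)) v)) \<longlongrightarrow> blinfun_apply f (blinfun_apply P v)) F"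
    and Q: "\<And>(f :: 'e \<Rightarrow>\<^sub>L real) v. ((\<lambda>n. blinfun_apply f (blinfun_apply (h (y n)) v)) \<longlongrightarrow> blinfun_apply f (blinfun_apply Q v)) F"
    and c0: "\<And>n. x n \<in> c0" "\<And>n. y n \<in> c0"
  shows "blinfun_apply P (blinfun_apply Q v) = blinfun_apply Q (blinfun_apply P v)"
proof (rule blinfun_separates)
  fix f :: "'e \<Rightarrow>\<^sub>L real"
  have Ph: "blinfun_apply P (blinfun_apply (h z) v) = blinfun_apply (h z) (blinfun_apply P v)"
    if z: "z \<in> c0" for z
  proof (rule blinfun_separates)
    fix g :: "'e \<Rightarrow>\<^sub>L real"
    show "blinfun_apply g (blinfun_apply P (blinfun_apply (h z) v)) = blinfun_apply g (blinfun_apply (h z) (blinfun_apply P v))"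
      using P[of g "blinfun_apply (h z) v"] P[of "g o\<^sub>L h z" v] commute[OF z c0(1)]
      by (intro tendsto_unique[OF F]) auto
  qed
  show "blinfun_apply f (blinfun_apply P (blinfun_apply Q v)) = blinfun_apply f (blinfun_apply Q (blinfun_apply P v))"
    using Q[of "f o\<^sub>L P" v] Q[of f "blinfun_apply P v"] Ph[OF c0(2)]
    by (intro tendsto_unique[OF F]) auto
qed

text \<open>The error splits in halves: the interlaced reading puts \<open>?R\<close> within e/2 of
  the identity on \<open>G\<close>, and the separated reading approximates \<open>?R\<close> to
  within e/2 by some \<open>h x\<close>.\<close>

lemma far_weakly_close:
  fixes G :: "(('e \<Rightarrow>\<^sub>L real) \<times> 'e) set"
  assumes G: "finite G" and e: "e > 0"
  obtains x where "x \<in> summing_lattice" "norm x \<ge> 1"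
    "\<And>f v. (f, v) \<in> G \<Longrightarrow> \<bar>blinfun_apply f (blinfun_apply (h x) v) - blinfun_apply f v\<bar> < e"
proof -
  \<comment> \<open>A positive bound for all functionals in \<open>G\<close>, so that moving each
    vector by at most \<eta> = e/(2B) changes the tested values by at most e/2.\<close>
  define B where "B = 1 + (\<Sum>(f, v)\<in>G. norm f)"
  have fB: "norm f \<le> B" if "(f, v) \<in> G" for f v
    using member_le_sum[OF that, of "\<lambda>(f, v). norm f"] G by (auto simp: B_def)
  have B: "B > 0" unfolding B_def by (auto intro!: add_pos_nonneg sum_nonneg)
  define \<eta> where "\<eta> = e / (2 * B)"
  have \<eta>: "\<eta> > 0" using e B by (simp add: \<eta>_def)
  have f\<eta>: "norm f * \<eta> \<le> e / 2" if "(f, v) \<in> G" for f v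
    using mult_right_mono[OF fB[OF that], of \<eta>] \<eta> B by (simp add: \<eta>_def)
  obtain \<rho> where \<rho>: "\<And>v. \<rho> v > 0"
    "\<And>v x. x \<in> c0 \<Longrightarrow> norm x \<le> \<rho> v \<Longrightarrow> norm (blinfun_apply (h x) v - v) \<le> \<eta>"
    using continuous[OF \<eta>] by metis
  define r where "r = Min (insert 1 (\<rho> ` snd ` G))"
  have "r > 0" using G \<rho>(1) by (simp add: r_def)
  have r: "r \<le> \<rho> v" if "(f, v) \<in> G" for f v
    unfolding r_def using G that by (intro Min_le) force+
  \<comment> \<open>The step size 1/k is within the common continuity radius \<open>r\<close>, yet
    \<open>k\<close> steps add up to height 1.\<close>
  obtain k :: nat where k: "k > 0" "inverse (real k) < r"
    using ex_inverse_of_nat_less[OF \<open>r > 0\<close>] by blast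
  define q :: rat where "q = inverse (of_nat k)"
  have q: "(of_rat q :: real) = inverse (real k)"
    by (simp add: q_def of_rat_inverse)
  obtain F :: "nat filter" where F: "ultrafilter F" "F \<le> sequentially"
    by (rule ultrafilter_exists[OF sequentially_bot])
  have nb: "F \<noteq> bot" using F by (simp add: ultrafilter_def)
  have lim: "\<exists>P :: 'e \<Rightarrow>\<^sub>L 'e. \<forall>(f :: 'e \<Rightarrow>\<^sub>L real) v.
      ((\<lambda>n. blinfun_apply f (blinfun_apply (h (of_rat q *\<^sub>R summing n)) v)) \<longlongrightarrow> blinfun_apply f (blinfun_apply P v)) F" for q
    by (rule reflexive_weak_operator_limit[OF reflexive F(1), where T = "\<lambda>n. h (of_rat q *\<^sub>R summing n)"])
      (auto simp: isometric scaleR_summing_c0)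
  obtain P :: "'e \<Rightarrow>\<^sub>L 'e" where P: "\<And>(f :: 'e \<Rightarrow>\<^sub>L real) v.
      ((\<lambda>n. blinfun_apply f (blinfun_apply (h (of_rat q *\<^sub>R summing n)) v)) \<longlongrightarrow> blinfun_apply f (blinfun_apply P v)) F"
    using lim[of q] by blast
  obtain Q :: "'e \<Rightarrow>\<^sub>L 'e" where Q: "\<And>(f :: 'e \<Rightarrow>\<^sub>L real) v.
      ((\<lambda>n. blinfun_apply f (blinfun_apply (h (of_rat (- q) *\<^sub>R summing n)) v)) \<longlongrightarrow> blinfun_apply f (blinfun_apply Q v)) F"
    using lim[of "- q"] by blast
  let ?p = "blinfun_apply P" and ?q = "blinfun_apply Q"
  let ?R = "\<lambda>v. (?q ^^ k) ((?p ^^ k) v)"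
  have R: "((\<lambda>v. ?p (?q v)) ^^ k) v = ?R v" for v
    by (intro funpow_comp_commute wot_limits_commute[OF nb P Q] scaleR_summing_c0)
  have close: "\<bar>blinfun_apply f (?R v) - blinfun_apply f v\<bar> \<le> e / 2" if fv: "(f, v) \<in> G" for f v
  proof -
    have "\<bar>blinfun_apply f (blinfun_apply (h 0) (((\<lambda>v. ?p (?q v)) ^^ k) v)) - blinfun_apply f v\<bar> \<le> norm f * \<eta>"
      using r[OF fv] k \<rho>(2) q
      by (intro interlaced_limit_close[OF nb F(2) P Q[unfolded of_rat_minus], where M = 0]) auto
    then show ?thesis
      using f\<eta>[OF fv] by (simp add: zero R)
  qed
  \<comment> \<open>In \<open>?R\<close> the power of \<open>?q\<close> is outermost, so the
    negative block \<open>x\<close> is chosen first and the positive block \<open>y\<close> may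
    depend on it.\<close>
  define Y where "Y x = {y \<in> summing_lattice. norm (x + y) \<ge> 1}" for x
  have "wot_adherent ?R {x + y | x y. x \<in> block (of_rat (- q)) k 0 \<and> y \<in> Y x}"
  proof (rule wot_adherent_comp[where S = "?q ^^ k" and T = "?p ^^ k"])
    show "wot_adherent (?q ^^ k) (block (of_rat (- q)) k 0)"
      by (rule wot_adherent_block[OF nb F(2) Q])
    fix x assume "x \<in> block (of_rat (- q)) k 0"
    then obtain M where M: "\<And>i. i > M \<Longrightarrow> apply_bcontfun x i = 0"
      by (auto simp: block_def)
    have "norm (x + y) \<ge> 1" if "y \<in> block (of_rat q) k (Suc M)" for y
    proof -
      \<comment> \<open>One index past the support of \<open>x\<close> nothing cancels, and
        \<open>y\<close> has the value k * (1/k).\<close>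
      have "apply_bcontfun (x + y) (Suc M) = 1"
        using that M[of "Suc M"] k(1) by (simp add: block_def q)
      then show ?thesis
        using norm_bounded[of "x + y" "Suc M"] by simp
    qed
    then have "block (of_rat q) k (Suc M) \<subseteq> Y x"
      by (auto simp: Y_def block_def)
    then show "wot_adherent (?p ^^ k) (Y x)"
      by (rule wot_adherent_mono[OF wot_adherent_block[OF nb F(2) P]])
    show "Y x \<subseteq> c0"
      using summing_lattice_subset_c0 by (auto simp: Y_def)
  qed (rule block_subset_c0)
  from wot_adherentD[OF this G half_gt_zero[OF e]] obtain x where
    "x \<in> {x + y | x y. x \<in> block (of_rat (- q)) k 0 \<and> y \<in> Y x}" and
    x: "\<And>f v. (f, v) \<in> G \<Longrightarrow> \<bar>blinfun_apply f (blinfun_apply (h x) v) - blinfun_apply f (?R v)\<bar> < e / 2"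
    by blast
  then have "x \<in> summing_lattice" "norm x \<ge> 1"
    by (auto simp: Y_def block_def intro: add_summing_lattice)
  moreover have "\<bar>blinfun_apply f (blinfun_apply (h x) v) - blinfun_apply f v\<bar> < e" if "(f, v) \<in> G" for f v
    using x[OF that] close[OF that] by linarith
  ultimately show ?thesis using that by blast
qed

text \<open>A small piece exists around some orbit point \<open>h y v\<close>. Composing its
  functionals with \<open>h y\<close> moves it back to \<open>v\<close>, and the isometry
  \<open>h y\<close> preserves the diameter bound.\<close>

lemma orbit_weak_neighbourhood:
  assumes "\<delta> > 0"
  obtains W :: "(('e \<Rightarrow>\<^sub>L real) \<times> real) set"
  where "finite W" "\<forall>(f, c)\<in>W. c < blinfun_apply f v"
    "\<And>x. x \<in> summing_lattice \<Longrightarrow> \<forall>(f, c)\<in>W. c < blinfun_apply f (blinfun_apply (h x) v)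
      \<Longrightarrow> norm (blinfun_apply (h x) v - v) \<le> \<delta>"
proof -
  let ?A = "(\<lambda>x. blinfun_apply (h x) v) ` summing_lattice"
  have L: "x \<in> c0" if "x \<in> summing_lattice" for x
    using that summing_lattice_subset_c0 by blast
  have ne: "?A \<noteq> {}" using zero_summing_lattice by blast
  have bdd: "bounded ?A" unfolding bounded_iff by (rule exI[of _ "norm v"]) (simp add: isometric L)
  have sub: "?A \<subseteq> closure (span ?A)" using span_superset closure_subset by (rule order_trans)
  have cnt: "countable ?A" using countable_summing_lattice by (rule countable_image)
  obtain u and W :: "(('e \<Rightarrow>\<^sub>L real) \<times> real) set" where u: "u \<in> ?A" "finite W"
      "\<forall>(f, c)\<in>W. c < blinfun_apply f u"
      "\<And>u'. u' \<in> ?A \<Longrightarrow> \<forall>(f, c)\<in>W. c < blinfun_apply f u' \<Longrightarrow> norm (u' - u) \<le> \<delta>"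
    by (rule reflexive_small_weakly_open_piece[OF reflexive ne bdd sub cnt assms]) blast
  then obtain y where y: "y \<in> summing_lattice" "u = blinfun_apply (h y) v" by blast
  define W' where "W' = (\<lambda>(f, c). (f o\<^sub>L h y, c)) ` W"
  have fin: "finite W'" using u(2) by (simp add: W'_def)
  have W'v: "\<forall>(f, c)\<in>W'. c < blinfun_apply f v"
    using u(3) by (auto simp: W'_def y(2))
  have small: "norm (blinfun_apply (h x) v - v) \<le> \<delta>"
    if x: "x \<in> summing_lattice" "\<forall>(f, c)\<in>W'. c < blinfun_apply f (blinfun_apply (h x) v)" for x
  proof -
    have yx: "blinfun_apply (h (y + x)) v = blinfun_apply (h y) (blinfun_apply (h x) v)"
      using add L x(1) y(1) by blast
    have "\<forall>(f, c)\<in>W. c < blinfun_apply f (blinfun_apply (h (y + x)) v)"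
      using x(2) by (auto simp: W'_def yx)
    then have "norm (blinfun_apply (h (y + x)) v - u) \<le> \<delta>"
      using x(1) y(1) by (intro u(4)) (auto intro: add_summing_lattice)
    then have "norm (blinfun_apply (h y) (blinfun_apply (h x) v - v)) \<le> \<delta>"
      by (simp add: yx y(2) blinfun.diff_right)
    then show ?thesis
      using isometric[OF L[OF y(1)]] by simp
  qed
  show ?thesis
    using that[OF fin W'v small] by blast
qed

theorem far_strongly_close:
  assumes V: "finite V" and \<delta>: "\<delta> > 0"
  obtains x where "x \<in> c0" "norm x \<ge> 1" "\<And>v. v \<in> V \<Longrightarrow> norm (blinfun_apply (h x) v - v) \<le> \<delta>"
proof -
  have "\<exists>W :: (('e \<Rightarrow>\<^sub>L real) \<times> real) set. finite W \<and> (\<forall>(f, c)\<in>W. c < blinfun_apply f v) \<and>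
      (\<forall>x\<in>summing_lattice. (\<forall>(f, c)\<in>W. c < blinfun_apply f (blinfun_apply (h x) v))
        \<longrightarrow> norm (blinfun_apply (h x) v - v) \<le> \<delta>)" for v
    by (rule orbit_weak_neighbourhood[OF \<delta>, of v]) blast
  then obtain W :: "'e \<Rightarrow> (('e \<Rightarrow>\<^sub>L real) \<times> real) set" where W: "\<And>v. finite (W v)"
      "\<And>v. \<forall>(f, c)\<in>W v. c < blinfun_apply f v"
      "\<And>v x. x \<in> summing_lattice \<Longrightarrow> (\<forall>(f, c)\<in>W v. c < blinfun_apply f (blinfun_apply (h x) v))
        \<Longrightarrow> norm (blinfun_apply (h x) v - v) \<le> \<delta>"
    by metis
  \<comment> \<open>The least slack in the finitely many strict inequalities; the element 1 covers
    the case that there are none.\<close>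
  define e where "e = Min (insert 1 ((\<lambda>(v, f, c). blinfun_apply f v - c) ` Sigma V W))"
  have fin: "finite (Sigma V W)" using V W(1) by blast
  have e: "e > 0" using fin W(2) by (force simp: e_def)
  have le: "e \<le> blinfun_apply f v - c" if "v \<in> V" "(f, c) \<in> W v" for v f c
    unfolding e_def using fin that by (intro Min_le) force+
  obtain x where x: "x \<in> summing_lattice" "norm x \<ge> 1"
    "\<And>f v. (f, v) \<in> (\<lambda>(v, f, c). (f, v)) ` Sigma V W
      \<Longrightarrow> \<bar>blinfun_apply f (blinfun_apply (h x) v) - blinfun_apply f v\<bar> < e"
    by (rule far_weakly_close[OF finite_imageI[OF fin] e]) blast
  have "norm (blinfun_apply (h x) v - v) \<le> \<delta>" if v: "v \<in> V" for v
  proof (rule W(3)[OF x(1)], clarify)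
    fix f c assume fc: "(f, c) \<in> W v"
    then have "(f, v) \<in> (\<lambda>(v, f, c). (f, v)) ` Sigma V W"
      using v by force
    then show "c < blinfun_apply f (blinfun_apply (h x) v)"
      using x(3)[of f v] le[OF v fc] by linarith
  qed
  then show ?thesis
    using x summing_lattice_subset_c0 that by blast
qed

end

section \<open>The topology of the isometry group\<close>

text \<open>The topology is pulled back from a product, so a basic box restricts only finitely many
  coordinates; the least of their radii is \<delta>.\<close>

lemma strong_operator_topology_contains_basis:
  fixes T :: "'a::real_normed_vector \<Rightarrow>\<^sub>L 'b::real_normed_vector"
  assumes "openin strong_operator_topology U" "T \<in> U"
  obtains V \<delta> where "finite V" "\<delta> > 0"
    "\<And>S. (\<And>v. v \<in> V \<Longrightarrow> norm (blinfun_apply S v - blinfun_apply T v) < \<delta>) \<Longrightarrow> S \<in> U"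
proof -
  obtain O' where O': "open O'" "U = blinfun_apply -` O'"
    using assms(1) unfolding strong_operator_topology_def openin_pullback_topology by auto
  then have "openin (product_topology (\<lambda>_. euclidean) UNIV) O'"
    by (simp add: open_fun_def)
  from product_topology_open_contains_basis[OF this, of "blinfun_apply T"] O'(2) assms(2)
  obtain X where X: "\<And>v. blinfun_apply T v \<in> X v" "\<And>v. open (X v)" "finite {v. X v \<noteq> UNIV}"
      "(\<Pi>\<^sub>E v\<in>UNIV. X v) \<subseteq> O'"
    by (auto simp: PiE_iff)
  obtain d where d: "\<And>v. d v > 0" "\<And>v. ball (blinfun_apply T v) (d v) \<subseteq> X v"
  proof -
    have "\<forall>v. \<exists>d>0. ball (blinfun_apply T v) d \<subseteq> X v"
      using openE[OF X(2) X(1)] by blast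
    then show ?thesis using that by metis
  qed
  define V where "V = {v. X v \<noteq> UNIV}"
  define \<delta> where "\<delta> = Min (insert 1 (d ` V))"
  have V: "finite V" using X(3) by (simp add: V_def)
  have "\<delta> > 0" using V d(1) by (simp add: \<delta>_def)
  moreover have "S \<in> U" if S: "\<And>v. v \<in> V \<Longrightarrow> norm (blinfun_apply S v - blinfun_apply T v) < \<delta>" for S
  proof -
    have "blinfun_apply S v \<in> X v" for v
    proof (cases "v \<in> V")
      case True
      then have "\<delta> \<le> d v" using V by (simp add: \<delta>_def)
      then show ?thesis
        using S[OF True] d(2)[of v] by (auto simp: dist_norm norm_minus_commute)
    qed (simp add: V_def)
    then show ?thesis
      using X(4) by (auto simp: O'(2) PiE_iff)
  qed
  ultimately show ?thesis using V that by blast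
qed

theorem theorem4p1:
  "\<not> reflexively_representable_on TYPE('e::banach) c0_group (top_of_set c0)"
proof
  assume "reflexively_representable_on TYPE('e) c0_group (top_of_set c0)"
  then obtain h :: "(nat \<Rightarrow>\<^sub>C real) \<Rightarrow> 'e \<Rightarrow>\<^sub>L 'e" where refl: "reflexive_space TYPE('e)"
    and hom: "h \<in> hom c0_group isometry_group"
    and emb: "embedding_map (top_of_set c0) (subtopology strong_operator_topology (carrier isometry_group)) h"
    by (auto simp: reflexively_representable_on_def)
  have iso: "norm (blinfun_apply (h x) v) = norm v" if "x \<in> c0" for x v
    using hom that by (auto simp: hom_def c0_group_def isometry_group_def)
  have add: "blinfun_apply (h (x + y)) v = blinfun_apply (h x) (blinfun_apply (h y) v)"
    if "x \<in> c0" "y \<in> c0" for x y v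
    using hom that by (auto simp: hom_def c0_group_def isometry_group_def)
  have 0: "0 \<in> c0" by (rule subspace_0[OF subspace_c0])
  have zero: "blinfun_apply (h 0) v = v" for v
  proof -
    \<comment> \<open>\<open>h 0\<close> is idempotent and isometric, hence the identity.\<close>
    have "norm (blinfun_apply (h 0) (blinfun_apply (h 0) v - v)) = 0"
      using add[OF 0 0, of v] by (simp add: blinfun.diff_right)
    then show ?thesis using iso[OF 0] by simp
  qed
  have homeo: "homeomorphic_map (top_of_set c0)
      (subtopology strong_operator_topology (carrier isometry_group \<inter> h ` c0)) h"
    using emb by (simp add: embedding_map_def subtopology_subtopology)
  then have "continuous_map (top_of_set c0) strong_operator_topology h"
    using homeomorphic_imp_continuous_map continuous_map_in_subtopology by blast
  then have "continuous_on c0 (\<lambda>x. blinfun_apply (h x) v)" for v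
    by (simp add: continuous_on_strong_operator_topo_iff_coordinatewise)
  then have cont: "\<exists>\<rho>>0. \<forall>x\<in>c0. norm x \<le> \<rho> \<longrightarrow> norm (blinfun_apply (h x) v - v) \<le> \<eta>"
    if \<eta>: "\<eta> > 0" for \<eta> v
  proof -
    obtain d where d: "d > 0" "\<And>x. x \<in> c0 \<Longrightarrow> norm x < d \<Longrightarrow> norm (blinfun_apply (h x) v - v) < \<eta>"
      using \<open>\<And>v. continuous_on c0 (\<lambda>x. blinfun_apply (h x) v)\<close>[of v] 0 \<eta>
      unfolding continuous_on_iff by (metis diff_zero dist_norm zero)
    then show ?thesis by (intro exI[of _ "d / 2"]) force
  qed
  interpret c0_representation h
    by (unfold_locales) (use refl zero add iso cont in auto)
  \<comment> \<open>The image of the open unit ball is relatively open and contains the identity, so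
    it must contain every \<open>h x\<close> that is strongly close to the identity, even one with
    norm x \<ge> 1; injectivity then gives the contradiction.\<close>
  have "openin (top_of_set c0) (c0 \<inter> ball 0 1)"
    by (rule openin_open_Int) simp
  then have "openin (subtopology strong_operator_topology (carrier isometry_group \<inter> h ` c0)) (h ` (c0 \<inter> ball 0 1))"
    using homeo homeomorphic_map_openness_eq by blast
  then obtain U where U: "openin strong_operator_topology U"
      "h ` (c0 \<inter> ball 0 1) = U \<inter> (carrier isometry_group \<inter> h ` c0)"
    unfolding openin_subtopology by blast
  have "h 0 \<in> h ` (c0 \<inter> ball 0 1)" using 0 by simp
  then have "h 0 \<in> U" using U(2) by blast
  then obtain V \<delta> where V: "finite V" "\<delta> > 0"
      "\<And>S. (\<And>v. v \<in> V \<Longrightarrow> norm (blinfun_apply S v - blinfun_apply (h 0) v) < \<delta>) \<Longrightarrow> S \<in> U"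
    using strong_operator_topology_contains_basis[OF U(1)] by blast
  obtain x where x: "x \<in> c0" "norm x \<ge> 1" "\<And>v. v \<in> V \<Longrightarrow> norm (blinfun_apply (h x) v - v) \<le> \<delta> / 2"
    using far_strongly_close[OF V(1) half_gt_zero[OF V(2)]] by blast
  have "h x \<in> U"
    using x(3) V(2) by (intro V(3)) (force simp: zero)
  moreover have "h x \<in> carrier isometry_group"
    using hom x(1) by (auto simp: hom_def c0_group_def)
  ultimately have "h x \<in> h ` (c0 \<inter> ball 0 1)"
    unfolding U(2) using x(1) by blast
  then obtain y where y: "y \<in> c0" "norm y < 1" "h x = h y"
    by auto
  have "inj_on h c0"
    using homeo homeomorphic_imp_injective_map by fastforce
  then have "x = y" using x(1) y by (auto dest: inj_onD)
  then show False using x(2) y(2) by simp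
qed

end
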